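(* Suppose that one of the following holds: (i) $S\neq\varnothing$, $\operatorname{ran}A$ is closed and $\operatorname{par}U+\ker A$ is closed; (ii) $V$ is a closed affine subspace of $X$, $f=\tfrac12\operatorname{dist}^2(\cdot,V)$, and $U+V$ is closed; (iii) $X$ is finite-dimensional. Let $(\alpha_k)_{k\in\mathbb{N}}$ be a sequence of real numbers, let $x_0\in X$, set $r_0:=0\in X$, and for every $k\in\mathbb{N}$ set $$x_{k+1}:=T(x_k+r_k),\qquad r_{k+1}:=\alpha_k(x_{k+1}-x_k).$$ If $F(x_k)-\mu\to0$, then $x_k\to P_Sx_0$ (strongly). In particular, if $(t_k)_{k\in\mathbb{N}}$ is a sequence of strictly positive real numbers such that for every $k\in\mathbb{N}$ one has $t_k\ge\frac{k+2}{2}\ge1=t_0$ and $t_k^2\ge t_{k+1}^2-t_{k+1}$, and $\alpha_k:=\frac{t_k-1}{t_{k+1}}$ for every $k\in\mathbb{N}$, then the sequence defined by $y_0:=x_0$, $x_{k+1}:=Ty_k$, $y_{k+1}:=x_{k+1}+\alpha_k(x_{k+1}-x_k)$ (for $k\in\mathbb{N}$) satisfies $x_k\to P_Sx_0$.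
   Context: $X$ and $Y$ are real Hilbert spaces, $A:X\to Y$ is linear and continuous, $b\in Y$, and $U$ is a (nonempty) closed affine subspace of $X$. For an affine subspace $W$, $\operatorname{par}W:=W-W$ is its parallel linear subspace. For a nonempty closed convex set $C\subseteq X$, $P_C$ denotes the orthogonal projection onto $C$, $\operatorname{dist}(x,C):=\|x-P_Cx\|$, and $\iota_C$ is the indicator function of $C$ ($0$ on $C$, $+\infty$ elsewhere). Consider minimizing $\tfrac12\|Ax-b\|^2$ subject to $x\in U$; set $f:=\tfrac12\|A(\cdot)-b\|^2$, $g:=\iota_U$, $F:=f+g$, let $S:=\operatorname{argmin}F$ be the set of minimizers of $F$ over $X$, and let $\mu:=\inf F(X)$ (equal to $\min F(X)$ when $S\ne\varnothing$). Set $\beta:=\|A^*A\|$, assumed to be strictly positive, and let $T:X\to X$ be the proximal-gradient operator $$T:=P_U\bigl(\mathrm{Id}-\tfrac1\beta A^*(A(\cdot)-b)\bigr).$$ In case (ii), the condition $f=\tfrac12\operatorname{dist}^2(\cdot,V)$ means that $A,b$ are such that $\tfrac12\|Ax-b\|^2=\tfrac12\operatorname{dist}^2(x,V)$ for all $x\in X$. *)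

theory Defs
  imports "HOL-Analysis.Analysis"
begin

(* Hilbert spaces are types of sort {real_inner, complete_space}.  The library's
   closest_point requires heine_borel, hence finite dimension, so the projection is defined
   here on an arbitrary real inner product space.  For C nonempty, closed and convex in a Hilbert
   space the chosen point exists and is unique. *)
definition proj :: "'a::real_inner set \<Rightarrow> 'a \<Rightarrow> 'a" where
  "proj C x = (SOME p. p \<in> C \<and> (\<forall>y\<in>C. norm (x - p) \<le> norm (x - y)))"

definition dist_set :: "'a::real_inner \<Rightarrow> 'a set \<Rightarrow> real" where
  "dist_set x C = norm (x - proj C x)"

definition par :: "'a::real_vector set \<Rightarrow> 'a set" where
  "par W = {u - v | u v. u \<in> W \<and> v \<in> W}"

(* The indicator of convex analysis; not the library's 0/1-valued indicator. *)
definition iota :: "'a set \<Rightarrow> 'a \<Rightarrow> ereal" where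
  "iota C x = (if x \<in> C then 0 else \<infinity>)"

definition minimizers :: "('a \<Rightarrow> ereal) \<Rightarrow> 'a set" where
  "minimizers F = {x. is_arg_min F (\<lambda>_. True) x}"

definition finite_dim :: "'a::real_vector itself \<Rightarrow> bool" where
  "finite_dim _ \<longleftrightarrow> (\<exists>B::'a set. finite B \<and> span B = UNIV)"

end

theory Submission
  imports Defs
begin

text \<open>
  Let \<open>K\<close> be the intersection of \<open>par U\<close> with the kernel of \<open>A\<close>.  Every step of the
  proximal-gradient operator moves orthogonally to \<open>K\<close>, because both the gradient and the
  projection residual are orthogonal to \<open>K\<close>; extrapolation along previous steps keeps this.
  Since \<open>S\<close> is a translate of \<open>K\<close>, all iterates have the same projection \<open>p\<close> onto \<open>S\<close>.
  Each of the three hypotheses makes \<open>A U\<close> closed, so \<open>S\<close> is nonempty and, by the open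
  mapping theorem on \<open>par U\<close>, \<open>norm (u - p) \<le> C * norm (A (u - p))\<close> for all \<open>u\<close> in \<open>U\<close> with
  \<open>u - p\<close> orthogonal to \<open>K\<close>.  As \<open>f u - \<mu> = 1/2 * (norm (A (u - p)))\<^sup>2\<close> on \<open>U\<close>, convergence of
  the values forces convergence of the iterates.  For the second part the values converge
  by the rate of Beck and Teboulle.
\<close>

subsection \<open>Projections and adjoints in Hilbert spaces\<close>

text \<open>A minimizing sequence is Cauchy by the parallelogram identity, and its limit attains the
  infimum. This existence is what gives the choice in \<open>proj\<close> its meaning.\<close>

lemma proj_closest:
  fixes C :: "'a::{real_inner,complete_space} set"
  assumes "closed C" "convex C" "C \<noteq> {}"
  shows "proj C x \<in> C" and "y \<in> C \<Longrightarrow> norm (x - proj C x) \<le> norm (x - y)"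
proof -
  define d where "d = Inf ((\<lambda>y. (norm (x - y))\<^sup>2) ` C)"
  have bdd: "bdd_below ((\<lambda>y. (norm (x - y))\<^sup>2) ` C)"
    by (rule bdd_belowI2[of _ 0]) simp
  have d_le: "d \<le> (norm (x - y))\<^sup>2" if "y \<in> C" for y
    unfolding d_def using bdd that by (rule cINF_lower)
  have "\<exists>y\<in>C. (norm (x - y))\<^sup>2 < d + 1 / Suc n" for n
    using cINF_less_iff[OF assms(3) bdd, of "d + 1 / Suc n"] by (simp add: d_def)
  then obtain z where zC: "\<And>n. z n \<in> C" and z: "\<And>n. (norm (x - z n))\<^sup>2 < d + 1 / Suc n"
    by metis
  have gap: "(norm (z m - z n))\<^sup>2 \<le> 2 / Suc m + 2 / Suc n" for m n
  proof -
    have "(1/2) *\<^sub>R z m + (1/2) *\<^sub>R z n \<in> C"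
      using assms(2) zC by (intro convexD) auto
    then have "d \<le> (norm (x - ((1/2) *\<^sub>R z m + (1/2) *\<^sub>R z n)))\<^sup>2"
      by (rule d_le)
    \<comment> \<open>Parallelogram identity; the midpoint of \<open>z m\<close> and
      \<open>z n\<close> lies in \<open>C\<close>, so its squared distance from \<open>x\<close> is
      at least \<open>d\<close>.\<close>
    moreover have "(norm (z m - z n))\<^sup>2 = 2 * (norm (x - z m))\<^sup>2 + 2 * (norm (x - z n))\<^sup>2
        - 4 * (norm (x - ((1/2) *\<^sub>R z m + (1/2) *\<^sub>R z n)))\<^sup>2"
      by (simp add: power2_norm_eq_inner inner_commute algebra_simps)
    ultimately show ?thesis
      using z[of m] z[of n] by simp
  qed
  have "Cauchy z"
  proof (rule metric_CauchyI)
    fix e :: real assume "e > 0"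
    then obtain N where N: "1 / real (Suc N) < e\<^sup>2 / 4"
      using nat_approx_posE[of "e\<^sup>2 / 4"] by auto
    have "dist (z m) (z n) < e" if "m \<ge> N" "n \<ge> N" for m n
    proof -
      have "2 / real (Suc m) \<le> 2 * (1 / real (Suc N))" "2 / real (Suc n) \<le> 2 * (1 / real (Suc N))"
        using that by (auto simp: field_simps)
      then have "(norm (z m - z n))\<^sup>2 < e\<^sup>2"
        using gap[of m n] N by linarith
      then show ?thesis
        using \<open>e > 0\<close> by (auto simp: dist_norm intro: power2_less_imp_less)
    qed
    then show "\<exists>M. \<forall>m\<ge>M. \<forall>n\<ge>M. dist (z m) (z n) < e" by blast
  qed
  then obtain p where p: "z \<longlonglongrightarrow> p"
    using convergent_eq_Cauchy by blast
  have "p \<in> C"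
    using \<open>closed C\<close> zC p closed_sequentially by blast
  have "(\<lambda>n. (norm (x - z n))\<^sup>2) \<longlonglongrightarrow> (norm (x - p))\<^sup>2"
    by (intro tendsto_intros p)
  moreover have "(\<lambda>n. d + 1 / real (Suc n)) \<longlonglongrightarrow> d"
    using tendsto_add[OF tendsto_const LIMSEQ_inverse_real_of_nat] by (simp add: inverse_eq_divide)
  moreover have "\<exists>N. \<forall>n\<ge>N. (norm (x - z n))\<^sup>2 \<le> d + 1 / real (Suc n)"
    using z less_imp_le by blast
  ultimately have "(norm (x - p))\<^sup>2 \<le> d"
    by (rule LIMSEQ_le)
  then have "norm (x - p) \<le> norm (x - y)" if "y \<in> C" for y
    using d_le[OF that] by (meson norm_ge_zero order_trans power2_le_imp_le)
  with \<open>p \<in> C\<close> have "\<exists>p. p \<in> C \<and> (\<forall>y\<in>C. norm (x - p) \<le> norm (x - y))" by blast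
  then have "proj C x \<in> C \<and> (\<forall>y\<in>C. norm (x - proj C x) \<le> norm (x - y))"
    unfolding proj_def by (rule someI_ex)
  then show "proj C x \<in> C" and "y \<in> C \<Longrightarrow> norm (x - proj C x) \<le> norm (x - y)" by auto
qed

text \<open>The points of parameter \<open>t\<close> on the lines from \<open>p\<close> to
  \<open>u\<close> and from \<open>p\<close> to \<open>v\<close> differ by exactly
  \<open>t *\<^sub>R (u - v)\<close>.\<close>

lemma affine_line_mem:
  assumes "affine U" "p \<in> U" "u \<in> U" "v \<in> U"
  shows "p + t *\<^sub>R (u - v) \<in> U"
proof -
  have "(1 - t) *\<^sub>R p + t *\<^sub>R u \<in> U" "(1 - t) *\<^sub>R p + t *\<^sub>R v \<in> U"
    using assms by (auto intro: mem_affine)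
  then have "p + 1 *\<^sub>R (((1 - t) *\<^sub>R p + t *\<^sub>R u) - ((1 - t) *\<^sub>R p + t *\<^sub>R v)) \<in> U"
    using assms mem_affine_3_minus by blast
  then show ?thesis by (simp add: algebra_simps)
qed

text \<open>The set contains the whole line through \<open>p\<close> in direction
  \<open>u - v\<close>, so a nonzero inner product would allow a closer point. Stated for a given
  closest point rather than for \<open>proj\<close>, it also applies to images under
  \<open>A\<close> before they are known to be closed.\<close>

lemma inner_minimal_affine_zero:
  fixes x :: "'a::real_inner"
  assumes "affine U" "p \<in> U" "\<And>y. y \<in> U \<Longrightarrow> norm (x - p) \<le> norm (x - y)" "u \<in> U" "v \<in> U"
  shows "(x - p) \<bullet> (u - v) = 0"
proof (cases "u = v")
  case False
  define w where "w = u - v"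
  \<comment> \<open>The minimizer of the quadratic giving the squared distance from \<open>x\<close>
    along the line.\<close>
  define t where "t = ((x - p) \<bullet> w) / (w \<bullet> w)"
  have w: "w \<bullet> w > 0" using False by (simp add: w_def)
  have "p + t *\<^sub>R w \<in> U"
    unfolding w_def using assms by (intro affine_line_mem)
  then have "(norm (x - p))\<^sup>2 \<le> (norm (x - (p + t *\<^sub>R w)))\<^sup>2"
    using assms(3) by (intro power_mono) auto
  also have "\<dots> = (norm (x - p))\<^sup>2 - 2 * t * ((x - p) \<bullet> w) + t * t * (w \<bullet> w)"
    by (simp add: power2_norm_eq_inner inner_commute algebra_simps)
  also have "t * t * (w \<bullet> w) = t * ((x - p) \<bullet> w)"
    using w by (simp add: t_def)
  finally have "((x - p) \<bullet> w)\<^sup>2 / (w \<bullet> w) \<le> 0"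
    by (simp add: t_def power2_eq_square)
  then have "((x - p) \<bullet> w)\<^sup>2 \<le> 0"
    using w by (simp add: divide_le_0_iff)
  then show ?thesis by (simp add: w_def)
qed simp

lemma proj_affine_orthogonal:
  fixes U :: "'a::{real_inner,complete_space} set"
  assumes "closed U" "affine U" "U \<noteq> {}" "u \<in> U" "v \<in> U"
  shows "(x - proj U x) \<bullet> (u - v) = 0"
  using assms proj_closest[OF assms(1) affine_imp_convex[OF assms(2)] assms(3)]
  by (intro inner_minimal_affine_zero) auto

text \<open>The residuals at \<open>p\<close> and at \<open>proj U x\<close> are both orthogonal to
  \<open>proj U x - p\<close>; subtracting them makes this vector orthogonal to itself.\<close>

lemma proj_affine_eq:
  fixes U :: "'a::{real_inner,complete_space} set"
  assumes "closed U" "affine U" "p \<in> U" "\<And>u. u \<in> U \<Longrightarrow> (x - p) \<bullet> (u - p) = 0"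
  shows "proj U x = p"
proof -
  have ne: "U \<noteq> {}" using assms by auto
  have q: "proj U x \<in> U"
    using assms ne by (intro proj_closest) (auto intro: affine_imp_convex)
  have "(x - p) \<bullet> (proj U x - p) = 0" "(x - proj U x) \<bullet> (proj U x - p) = 0"
    using assms q ne by (auto intro: proj_affine_orthogonal)
  then have "(proj U x - p) \<bullet> (proj U x - p) = 0"
    by (simp add: algebra_simps)
  then show ?thesis by simp
qed

section \<open>Riesz representation and the adjoint\<close>

text \<open>The residual \<open>e\<close> of a vector outside the kernel is orthogonal to the
  kernel, and every \<open>x\<close> is a kernel vector plus a multiple of \<open>e\<close>.\<close>

lemma riesz_representation:
  fixes \<phi> :: "'a::{real_inner,complete_space} \<Rightarrow> real"
  assumes "bounded_linear \<phi>"
  obtains w where "\<And>x. \<phi> x = x \<bullet> w"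
proof (cases "\<forall>x. \<phi> x = 0")
  case True
  then show ?thesis by (intro that[of 0]) simp
next
  case False
  interpret \<phi>: bounded_linear \<phi> by fact
  define N where "N = {x. \<phi> x = 0}"
  obtain a where a: "\<phi> a \<noteq> 0" using False by blast
  have N: "closed N" "affine N" "0 \<in> N"
    unfolding N_def affine_def
    by (auto intro!: closed_Collect_eq continuous_intros \<phi>.continuous_on simp: \<phi>.add \<phi>.scaleR)
  define e where "e = a - proj N a"
  have "proj N a \<in> N"
    using N by (intro proj_closest) (auto intro: affine_imp_convex)
  then have e: "\<phi> e = \<phi> a" by (simp add: N_def e_def \<phi>.diff)
  have orth: "n \<bullet> e = 0" if "n \<in> N" for n
    using proj_affine_orthogonal[of N n 0 a] N that by (auto simp: e_def inner_commute)
  have "e \<bullet> e \<noteq> 0" using e a by auto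
  have "\<phi> x = x \<bullet> ((\<phi> a / (e \<bullet> e)) *\<^sub>R e)" for x
  proof -
    have "x - (\<phi> x / \<phi> a) *\<^sub>R e \<in> N"
      using a e by (simp add: N_def \<phi>.diff \<phi>.scaleR)
    from orth[OF this] have "x \<bullet> e = (\<phi> x / \<phi> a) * (e \<bullet> e)"
      by (simp add: algebra_simps)
    then show ?thesis using a \<open>e \<bullet> e \<noteq> 0\<close> by simp
  qed
  then show ?thesis by (rule that)
qed

text \<open>\<open>adjoint\<close> is a choice of an operator with this property; the Riesz
  representation shows that one exists.\<close>

lemma adjoint_inner:
  fixes A :: "'a::{real_inner,complete_space} \<Rightarrow> 'b::real_inner"
  assumes "bounded_linear A"
  shows "x \<bullet> adjoint A y = A x \<bullet> y"
proof -
  have "\<exists>w. \<forall>x. A x \<bullet> y = x \<bullet> w" for y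
  proof -
    have "bounded_linear (\<lambda>x. A x \<bullet> y)"
      using bounded_linear_compose[OF bounded_linear_inner_left assms] .
    then show ?thesis using riesz_representation by metis
  qed
  then have "\<exists>B. \<forall>x y. A x \<bullet> y = x \<bullet> B y" by metis
  then have "\<forall>x y. A x \<bullet> y = x \<bullet> adjoint A y"
    unfolding adjoint_def by (rule someI_ex)
  then show ?thesis by simp
qed

lemma bounded_linear_adjoint:
  fixes A :: "'a::{real_inner,complete_space} \<Rightarrow> 'b::real_inner"
  assumes A: "bounded_linear A"
  shows "bounded_linear (adjoint A)"
proof (rule bounded_linear_intro)
  note [simp] = adjoint_inner[OF A]
  show "adjoint A (y + z) = adjoint A y + adjoint A z" for y z
    by (rule vector_eq_rdot[THEN iffD1]) (simp add: inner_add_left inner_add_right inner_commute[of "adjoint A _"])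
  show "adjoint A (r *\<^sub>R y) = r *\<^sub>R adjoint A y" for r y
    by (rule vector_eq_rdot[THEN iffD1]) (simp add: inner_commute[of "adjoint A _"])
  show "norm (adjoint A y) \<le> norm y * onorm A" for y
  proof (cases "adjoint A y = 0")
    case False
    have "norm (adjoint A y) * norm (adjoint A y) = A (adjoint A y) \<bullet> y"
      by (metis adjoint_inner[OF A] norm_eq_square power2_eq_square power2_norm_eq_inner)
    also have "\<dots> \<le> norm (A (adjoint A y)) * norm y" by (rule norm_cauchy_schwarz)
    also have "\<dots> \<le> (onorm A * norm (adjoint A y)) * norm y"
      by (intro mult_right_mono onorm[OF A]) auto
    finally have "norm (adjoint A y) * norm (adjoint A y) \<le> (norm y * onorm A) * norm (adjoint A y)"
      by (simp add: algebra_simps)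
    then show ?thesis using False by simp
  qed (simp add: onorm_pos_le[OF A])
qed

text \<open>Cauchy-Schwarz for \<open>x \<bullet> adjoint A (A x)\<close>. It makes
  \<open>\<beta>\<close> the curvature constant of the quadratic upper bound behind each gradient
  step.\<close>

lemma norm_sq_le_onorm_adjoint:
  fixes A :: "'a::{real_inner,complete_space} \<Rightarrow> 'b::real_inner"
  assumes A: "bounded_linear A"
  shows "(norm (A x))\<^sup>2 \<le> onorm (adjoint A \<circ> A) * (norm x)\<^sup>2"
proof -
  have B: "bounded_linear (adjoint A \<circ> A)"
    unfolding o_def using bounded_linear_compose[OF bounded_linear_adjoint[OF A] A] .
  have "(norm (A x))\<^sup>2 = x \<bullet> adjoint A (A x)"
    by (simp add: adjoint_inner[OF A] power2_norm_eq_inner)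
  also have "\<dots> \<le> norm x * norm ((adjoint A \<circ> A) x)"
    by (simp add: norm_cauchy_schwarz)
  also have "\<dots> \<le> norm x * (onorm (adjoint A \<circ> A) * norm x)"
    by (intro mult_left_mono onorm[OF B]) auto
  finally show ?thesis by (simp add: power2_eq_square algebra_simps)
qed

subsection \<open>Closed images and the open mapping theorem\<close>

lemma geometric_steps_Cauchy:
  fixes s :: "nat \<Rightarrow> 'a::metric_space"
  assumes "\<And>n. dist (s n) (s (Suc n)) \<le> c / 2 ^ n"
  shows "dist (s n) (s (n + k)) \<le> 2 * c / 2 ^ n" and "Cauchy s"
proof -
  have c: "c \<ge> 0" using order_trans[OF zero_le_dist assms[of 0]] by simp
  \<comment> \<open>The subtracted term is the tail of the geometric series; it lets the induction
    on \<open>k\<close> close.\<close>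
  have step: "dist (s n) (s (n + k)) \<le> 2 * c / 2 ^ n - 2 * c / 2 ^ (n + k)" for n k
  proof (induction k)
    case (Suc k)
    have "dist (s n) (s (n + Suc k)) \<le> dist (s n) (s (n + k)) + dist (s (n + k)) (s (Suc (n + k)))"
      using dist_triangle by simp
    also have "\<dots> \<le> (2 * c / 2 ^ n - 2 * c / 2 ^ (n + k)) + c / 2 ^ (n + k)"
      by (intro add_mono Suc assms)
    also have "\<dots> = 2 * c / 2 ^ n - 2 * c / 2 ^ (n + Suc k)" by (simp add: field_simps)
    finally show ?case .
  qed simp
  show bound: "dist (s n) (s (n + k)) \<le> 2 * c / 2 ^ n" for n k
    using step[of n k] c by (smt (verit) divide_nonneg_nonneg zero_le_power)
  have "(\<lambda>n. 2 * c * (1/2) ^ n) \<longlonglongrightarrow> 2 * c * 0"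
    by (intro tendsto_intros LIMSEQ_power_zero) auto
  then have lim: "(\<lambda>n. 2 * c / 2 ^ n) \<longlonglongrightarrow> 0" by (simp add: power_divide)
  show "Cauchy s"
  proof (rule metric_CauchyI)
    fix e :: real assume "e > 0"
    then have "\<forall>\<^sub>F n in sequentially. 2 * c / 2 ^ n < e / 2"
      using order_tendstoD(2)[OF lim, of "e/2"] by simp
    then obtain N where N: "2 * c / 2 ^ N < e / 2"
      by (meson eventually_sequentially order_refl)
    have "dist (s N) (s m) < e / 2" if "m \<ge> N" for m
      using bound[of N "m - N"] N that by simp
    then have "dist (s m) (s n) < e" if "m \<ge> N" "n \<ge> N" for m n
      using that dist_triangle_half_r by blast
    then show "\<exists>M. \<forall>m\<ge>M. \<forall>n\<ge>M. dist (s m) (s n) < e" by blast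
  qed
qed

text \<open>With \<open>e\<close> the part of \<open>b\<close> orthogonal to \<open>span B\<close>,
  the larger span is the preimage of \<open>span B\<close> under the continuous map that removes the
  component along \<open>e\<close>.\<close>

lemma closed_span_finite:
  fixes B :: "'a::{real_inner,complete_space} set"
  assumes "finite B"
  shows "closed (span B)"
  using assms
proof (induction B)
  case empty
  then show ?case by simp
next
  case (insert b B)
  define e where "e = b - proj (span B) b"
  have pB: "proj (span B) b \<in> span B"
    using insert by (intro proj_closest) (auto intro: subspace_imp_convex span_0)
  have orth: "u \<bullet> e = 0" if "u \<in> span B" for u
    using proj_affine_orthogonal[of "span B" u 0 b] insert that
    by (auto simp: e_def inner_commute span_0 intro: subspace_imp_affine)
  \<comment> \<open>For \<open>b\<close> in the span, \<open>e\<close> vanishes and the quotient below is the junk value 0.\<close>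
  have "span (insert b B) = {y. y - ((y \<bullet> e) / (e \<bullet> e)) *\<^sub>R e \<in> span B}"
  proof (intro equalityI subsetI CollectI)
    fix y assume "y \<in> span (insert b B)"
    then obtain k where "y - k *\<^sub>R b \<in> span B" by (auto simp: span_insert)
    then have u: "y - k *\<^sub>R e \<in> span B"
      using span_add[OF _ span_scale[OF pB, of k], of "y - k *\<^sub>R b"]
      by (simp add: e_def algebra_simps)
    from orth[OF this] have "y \<bullet> e = k * (e \<bullet> e)" by (simp add: algebra_simps)
    then show "y - ((y \<bullet> e) / (e \<bullet> e)) *\<^sub>R e \<in> span B"
      using u by (cases "e = 0") auto
  next
    fix y assume "y \<in> {y. y - ((y \<bullet> e) / (e \<bullet> e)) *\<^sub>R e \<in> span B}"
    then obtain k where "y - k *\<^sub>R e \<in> span B" by blast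
    then have "y - k *\<^sub>R b \<in> span B"
      using span_diff[OF _ span_scale[OF pB, of k], of "y - k *\<^sub>R e"]
      by (simp add: e_def algebra_simps)
    then show "y \<in> span (insert b B)" by (auto simp: span_insert)
  qed
  also have "\<dots> = (\<lambda>y. y - ((y \<bullet> e) / (e \<bullet> e)) *\<^sub>R e) -` span B" by auto
  also have "closed \<dots>"
    by (intro closed_vimage insert.IH) (simp add: divide_inverse, intro continuous_intros)
  finally show ?case .
qed

text \<open>\<open>L\<close> has a finite basis, so its image is the span of a finite set in the
  Hilbert space of values.\<close>

lemma finite_dim_image_closed:
  fixes A :: "'a::real_vector \<Rightarrow> 'b::{real_inner,complete_space}"
  assumes "finite_dim TYPE('a)" "linear A" "subspace L"
  shows "closed (A ` L)"
proof -
  obtain E :: "'a set" where E: "finite E" "span E = UNIV"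
    using assms(1) by (auto simp: finite_dim_def)
  obtain B where B: "B \<subseteq> L" "independent B" "L \<subseteq> span B"
    using maximal_independent_subset by blast
  have "finite B"
    using independent_span_bound[OF E(1) B(2)] E(2) by simp
  moreover have "L = span B"
    using B assms(3) span_minimal by blast
  ultimately show ?thesis
    using closed_span_finite[of "A ` B"] linear_span_image[OF assms(2)] by simp
qed

section \<open>Open mapping onto a closed image\<close>

text \<open>Solving approximately for the current residual halves it each time; the corrections form
  a geometrically convergent series whose sum solves the equation exactly.\<close>

lemma approximate_solution_iterate:
  fixes A :: "'a::{real_normed_vector,complete_space} \<Rightarrow> 'b::real_normed_vector"
  assumes A: "bounded_linear A" and L: "subspace L" "closed L"
    and approx: "\<And>y. y \<in> A ` L \<Longrightarrow> \<exists>x\<in>L. norm x \<le> K * norm y \<and> norm (y - A x) \<le> norm y / 2"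
    and y: "y \<in> A ` L"
  shows "\<exists>x\<in>L. A x = y \<and> norm x \<le> 2 * K * norm y"
proof -
  interpret A: bounded_linear A by fact
  obtain h where h: "\<And>y. y \<in> A ` L \<Longrightarrow> h y \<in> L"
    "\<And>y. y \<in> A ` L \<Longrightarrow> norm (h y) \<le> K * norm y"
    "\<And>y. y \<in> A ` L \<Longrightarrow> norm (y - A (h y)) \<le> norm y / 2"
    using approx by metis
  define s where "s = rec_nat 0 (\<lambda>_ x. x + h (y - A x))"
  have s0: "s 0 = 0" and sS: "\<And>n. s (Suc n) = s n + h (y - A (s n))"
    by (simp_all add: s_def)
  have rest: "y - A x \<in> A ` L" if "x \<in> L" for x
    using y that L(1) by (auto simp: A.diff[symmetric] intro: subspace_diff)
  have sL: "s n \<in> L" for n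
    by (induction n) (use L(1) h(1) rest in \<open>auto simp: s0 sS subspace_0 subspace_add\<close>)
  have res: "norm (y - A (s n)) \<le> norm y / 2 ^ n" for n
  proof (induction n)
    case (Suc n)
    have "norm (y - A (s (Suc n))) \<le> norm (y - A (s n)) / 2"
      using h(3)[OF rest[OF sL]] by (simp add: sS A.add algebra_simps)
    also have "\<dots> \<le> norm y / 2 ^ n / 2" by (intro divide_right_mono Suc) simp
    finally show ?case by (simp add: mult.commute)
  qed (simp add: s0 A.zero)
  have "norm (h y) \<le> K * norm y" by (rule h(2)[OF y])
  \<comment> \<open>The sign of \<open>K\<close> comes from the bound at \<open>y\<close> itself;
    for \<open>y = 0\<close> all residuals vanish anyway.\<close>
  have K: "K \<ge> 0 \<or> norm y = 0"
    using \<open>norm (h y) \<le> K * norm y\<close> norm_ge_zero[of "h y"]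
    by (metis norm_ge_zero order_trans zero_le_mult_iff order_antisym_conv)
  have step: "dist (s n) (s (Suc n)) \<le> K * norm y / 2 ^ n" for n
  proof -
    have "dist (s n) (s (Suc n)) \<le> K * norm (y - A (s n))"
      using h(2)[OF rest[OF sL]] by (simp add: sS dist_norm)
    also have "\<dots> \<le> K * (norm y / 2 ^ n)"
      using K
    proof
      assume "K \<ge> 0"
      then show ?thesis by (intro mult_left_mono res)
    qed (use res[of n] in simp)
    finally show ?thesis by simp
  qed
  obtain x where x: "s \<longlonglongrightarrow> x"
    using geometric_steps_Cauchy(2)[OF step] convergent_eq_Cauchy by blast
  have "x \<in> L" using L(2) sL x closed_sequentially by blast
  have "norm (s n) \<le> 2 * K * norm y" for n
    using geometric_steps_Cauchy(1)[OF step, of 0 n] by (simp add: s0 algebra_simps)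
  then have nx: "norm x \<le> 2 * K * norm y"
    by (intro LIMSEQ_le_const2[OF tendsto_norm[OF x]]) auto
  have "(\<lambda>n. norm (y - A (s n))) \<longlonglongrightarrow> norm (y - A x)"
    by (intro tendsto_intros A.tendsto x)
  moreover have "(\<lambda>n. norm y * (1/2) ^ n) \<longlonglongrightarrow> norm y * 0"
    by (intro tendsto_intros LIMSEQ_power_zero) auto
  moreover have "\<exists>N. \<forall>n\<ge>N. norm (y - A (s n)) \<le> norm y * (1/2) ^ n"
    using res by (simp add: power_divide)
  ultimately have "norm (y - A x) \<le> norm y * 0"
    by (rule LIMSEQ_le)
  then show ?thesis using \<open>x \<in> L\<close> nx by auto
qed

text \<open>The image of \<open>L\<close> is the union of the closures of the images of balls, so by
  Baire one of them has relative interior. Subtracting approximate preimages of two points there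
  yields approximate preimages of every \<open>y\<close>, which the iteration above makes
  exact.\<close>

lemma bounded_linear_open_onto_image:
  fixes A :: "'a::{real_normed_vector,complete_space} \<Rightarrow> 'b::{real_normed_vector,complete_space}"
  assumes A: "bounded_linear A" and L: "subspace L" "closed L" and R: "closed (A ` L)"
  obtains C where "C \<ge> 0" "\<And>y. y \<in> A ` L \<Longrightarrow> \<exists>x\<in>L. A x = y \<and> norm x \<le> C * norm y"
proof -
  interpret A: bounded_linear A by fact
  define G where "G = (\<lambda>n::nat. closure (A ` (L \<inter> cball 0 (real n))))"
  have GR: "G n \<subseteq> A ` L" for n
    unfolding G_def using R by (intro closure_minimal) auto
  have "A ` L \<subseteq> \<Union>(range G)"
  proof
    fix y assume "y \<in> A ` L"
    then obtain x where x: "x \<in> L" "y = A x" by blast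
    obtain n :: nat where "norm x \<le> real n" using real_arch_simple by blast
    then have "y \<in> G n"
      unfolding G_def using x closure_subset by fastforce
    then show "y \<in> \<Union>(range G)" by blast
  qed
  then have UG: "\<Union>(range G) = A ` L" using GR by blast
  \<comment> \<open>Baire's theorem in the closed subspace \<open>A ` L\<close>\<close>
  have "\<exists>n. top_of_set (A ` L) interior_of (G n) \<noteq> {}"
  proof (rule ccontr)
    assume "\<nexists>n. top_of_set (A ` L) interior_of (G n) \<noteq> {}"
    moreover have "closedin (top_of_set (A ` L)) (G n)" for n
      using GR by (simp add: closedin_closed_eq[OF R] G_def)
    moreover have "completely_metrizable_space (top_of_set (A ` L))"
      using R by (intro completely_metrizable_space_closedin completely_metrizable_space_euclidean)
        (simp only: closed_closedin)
    ultimately have "top_of_set (A ` L) interior_of (\<Union>(range G)) = {}"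
      by (intro Baire_category_alt) auto
    then have "A ` L = {}"
      using interior_of_topspace[of "top_of_set (A ` L)"] by (simp add: UG)
    then show False using subspace_0[OF L(1)] by blast
  qed
  then obtain n W y0 where W: "openin (top_of_set (A ` L)) W" "y0 \<in> W" "W \<subseteq> G n"
    by (auto simp: interior_of_def)
  then obtain e where e: "e > 0" "\<And>y. y \<in> A ` L \<Longrightarrow> dist y y0 < e \<Longrightarrow> y \<in> G n"
    unfolding openin_euclidean_subtopology_iff by blast
  have y0: "y0 \<in> A ` L" "y0 \<in> G n" using W GR by auto
  have near: "\<exists>a\<in>L. norm a \<le> n \<and> norm (y - A a) < d" if "y \<in> G n" "d > 0" for y d
  proof -
    have "y \<in> closure (A ` (L \<inter> cball 0 (real n)))" using that(1) by (simp add: G_def)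
    from closure_approachableD[OF this that(2)]
    show ?thesis by (auto simp: dist_norm)
  qed
  define K where "K = 4 * real n / e"
  have approx: "\<exists>x\<in>L. norm x \<le> K * norm y \<and> norm (y - A x) \<le> norm y / 2" if y: "y \<in> A ` L" for y
  proof (cases "y = 0")
    case True
    then show ?thesis using subspace_0[OF L(1)] by (intro bexI[of _ 0]) (auto simp: A.zero)
  next
    case False
    \<comment> \<open>This scaling puts \<open>y0 + c *\<^sub>R y\<close> at distance
      \<open>e / 2\<close> from \<open>y0\<close>. Two errors below \<open>e / 8\<close> then add up
      to at most half of \<open>c * norm y\<close>, and dividing \<open>2 * n\<close> by
      \<open>c\<close> gives the constant \<open>K\<close>.\<close>
    define c where "c = e / (2 * norm y)"
    have c: "c > 0" "c * norm y = e / 2" using e(1) False by (auto simp: c_def)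
    have "y0 + c *\<^sub>R y \<in> A ` L"
      using y0(1) y linear_subspace_image[OF A.linear_axioms L(1)]
      by (blast intro: subspace_add subspace_scale)
    moreover have "dist (y0 + c *\<^sub>R y) y0 < e"
      using e(1) c by (simp add: dist_norm)
    ultimately have yG: "y0 + c *\<^sub>R y \<in> G n" by (rule e(2))
    have "e / 8 > 0" using e(1) by simp
    obtain a where a: "a \<in> L" "norm a \<le> n" "norm (y0 + c *\<^sub>R y - A a) < e / 8"
      using near[OF yG \<open>e / 8 > 0\<close>] by blast
    obtain a' where a': "a' \<in> L" "norm a' \<le> n" "norm (y0 - A a') < e / 8"
      using near[OF y0(2) \<open>e / 8 > 0\<close>] by blast
    define x where "x = (1 / c) *\<^sub>R (a - a')"
    have "x \<in> L" using a a' L(1) by (auto simp: x_def intro: subspace_scale subspace_diff)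
    moreover have "norm x \<le> K * norm y"
    proof -
      have "norm (a - a') \<le> 2 * real n"
        using norm_triangle_ineq4[of a a'] a a' by linarith
      then have "norm x \<le> (1 / c) * (2 * real n)"
        using c(1) by (simp add: x_def divide_right_mono)
      also have "\<dots> = K * norm y" by (simp add: K_def c_def)
      finally show ?thesis .
    qed
    moreover have "norm (y - A x) \<le> norm y / 2"
    proof -
      have "c *\<^sub>R (y - A x) = (y0 + c *\<^sub>R y - A a) - (y0 - A a')"
        using c(1) by (simp add: x_def A.scaleR A.diff algebra_simps)
      then have "c * norm (y - A x) \<le> norm (y0 + c *\<^sub>R y - A a) + norm (y0 - A a')"
        using c(1) by (metis abs_of_pos norm_scaleR norm_triangle_ineq4)
      also have "\<dots> \<le> c * (norm y / 2)" using a(3) a'(3) c(2) by simp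
      finally show ?thesis using c(1) by simp
    qed
    ultimately show ?thesis by blast
  qed
  show ?thesis
  proof (rule that)
    show "2 * K \<ge> 0" using e(1) by (simp add: K_def)
    show "\<exists>x\<in>L. A x = y \<and> norm x \<le> 2 * K * norm y" if "y \<in> A ` L" for y
      using A L approx that by (rule approximate_solution_iterate)
  qed
qed

section \<open>Closed images from closed sums\<close>

text \<open>A limit of images has a preimage \<open>x\<close>. The open mapping bound gives
  corrections \<open>z n\<close> tending to 0 with \<open>x - z n\<close> in the closed sum, so
  \<open>x\<close> lies there too, and its kernel part is invisible to \<open>A\<close>.\<close>

lemma closed_image_of_closed_sum_kernel:
  fixes A :: "'a::{real_normed_vector,complete_space} \<Rightarrow> 'b::{real_normed_vector,complete_space}"
  assumes A: "bounded_linear A" and R: "closed (range A)" and L: "closed (L + {x. A x = 0})"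
  shows "closed (A ` L)"
proof -
  interpret A: bounded_linear A by fact
  obtain C where C: "\<And>y. y \<in> range A \<Longrightarrow> \<exists>x\<in>UNIV. A x = y \<and> norm x \<le> C * norm y"
    using bounded_linear_open_onto_image[OF A subspace_UNIV closed_UNIV R] by metis
  have "y \<in> A ` L" if seq: "\<And>n. v n \<in> A ` L" and lim: "v \<longlonglongrightarrow> y" for v y
  proof -
    have "\<exists>w. w \<in> L \<and> v n = A w" for n using seq[of n] by blast
    then obtain l where l: "\<And>n. l n \<in> L" "\<And>n. v n = A (l n)" by metis
    have "y \<in> range A"
      using R lim l closed_sequentially[of "range A" v y] by auto
    then obtain x where x: "y = A x" by blast
    have "\<exists>z. A z = A (x - l n) \<and> norm z \<le> C * norm (A (x - l n))" for n
      using C by blast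
    then obtain z where z: "\<And>n. A (z n) = A (x - l n)" "\<And>n. norm (z n) \<le> C * norm (A (x - l n))"
      by metis
    have "(\<lambda>n. C * norm (y - v n)) \<longlonglongrightarrow> C * norm (y - y)"
      by (intro tendsto_intros lim)
    then have "(\<lambda>n. C * norm (y - v n)) \<longlonglongrightarrow> 0" by simp
    then have "z \<longlonglongrightarrow> 0"
      by (rule Lim_null_comparison[rotated]) (use z in \<open>simp add: x l A.diff\<close>)
    then have "(\<lambda>n. x - z n) \<longlonglongrightarrow> x - 0" by (intro tendsto_intros)
    moreover have "x - z n \<in> L + {x. A x = 0}" for n
    proof -
      have "A (x - z n - l n) = 0" using z(1)[of n] by (simp add: A.diff)
      then have "l n + (x - z n - l n) \<in> L + {x. A x = 0}"
        using l(1) by (intro set_plus_intro) auto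
      then show ?thesis by simp
    qed
    ultimately have "x \<in> L + {x. A x = 0}"
      using closed_sequentially[OF L, of "\<lambda>n. x - z n" x] by simp
    then obtain m k where "m \<in> L" "A k = 0" "x = m + k" by (auto elim: set_plus_elim)
    then show ?thesis by (simp add: x A.add)
  qed
  then show ?thesis unfolding closed_sequential_limits by blast
qed

text \<open>The residual being a distance forces \<open>A\<close> to equal \<open>b\<close> on
  \<open>V\<close> and to be isometric on vectors orthogonal to the directions of \<open>V\<close>.
  Convergence of images thus lifts to convergence of the vectors from \<open>V\<close> to the points
  of \<open>U\<close>.\<close>

lemma closed_image_of_distance_residual:
  fixes A :: "'a::{real_inner,complete_space} \<Rightarrow> 'b::{real_inner,complete_space}"
  assumes A: "bounded_linear A"
    and V: "V \<noteq> {}" "closed V" "affine V" "\<And>x. norm (A x - b) = dist_set x V"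
    and UV: "closed (U + V)"
  shows "closed (A ` U)"
proof -
  interpret A: bounded_linear A by fact
  obtain v where v: "v \<in> V" using V(1) by blast
  have pV: "proj V x \<in> V" for x
    using V by (intro proj_closest) (auto intro: affine_imp_convex)
  have AV: "A q = b" if "q \<in> V" for q
  proof -
    have "proj V q = q" by (rule proj_affine_eq) (use V that in auto)
    then show ?thesis using V(4)[of q] by (simp add: dist_set_def)
  qed
  \<comment> \<open>The point \<open>v + w\<close> projects to \<open>v\<close>, so its distance
    from \<open>V\<close> is \<open>norm w\<close>, while its residual is
    \<open>A w\<close>.\<close>
  have iso: "norm (A w) = norm w" if "\<And>q q'. q \<in> V \<Longrightarrow> q' \<in> V \<Longrightarrow> w \<bullet> (q - q') = 0" for w
  proof -
    have "proj V (v + w) = v"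
      using V v that by (intro proj_affine_eq) auto
    then show ?thesis using V(4)[of "v + w"] AV[OF v] by (simp add: dist_set_def A.add)
  qed
  have "y \<in> A ` U" if seq: "\<And>n. s n \<in> A ` U" and lim: "s \<longlonglongrightarrow> y" for s y
  proof -
    have "\<exists>w. w \<in> U \<and> s n = A w" for n using seq[of n] by blast
    then obtain u where u: "\<And>n. u n \<in> U" "\<And>n. s n = A (u n)" by metis
    define d where "d = (\<lambda>n. u n - proj V (u n))"
    have Ad: "A (d n) = s n - b" for n
      using AV[OF pV] by (simp add: d_def A.diff u)
    have orth: "d n \<bullet> (q - q') = 0" if "q \<in> V" "q' \<in> V" for n q q'
      unfolding d_def using V that by (intro proj_affine_orthogonal)
    have "dist (d m) (d n) = dist (s m) (s n)" for m n
    proof -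
      have "norm (A (d m - d n)) = norm (d m - d n)"
        by (rule iso) (use orth in \<open>simp add: inner_diff_left\<close>)
      then show ?thesis by (simp add: dist_norm A.diff Ad)
    qed
    then have "Cauchy d"
      using LIMSEQ_imp_Cauchy[OF lim] by (simp add: Cauchy_def)
    then obtain d' where d': "d \<longlonglongrightarrow> d'" using convergent_eq_Cauchy by blast
    \<comment> \<open>Reflecting \<open>proj V (u n)\<close> through \<open>v\<close> stays in
      \<open>V\<close>; this turns a difference of points into a member of the sum, whose closedness
      is assumed.\<close>
    have "d n + 2 *\<^sub>R v \<in> U + V" for n
    proof -
      have "v + 1 *\<^sub>R (v - proj V (u n)) \<in> V"
        using V(3) v pV by (intro affine_line_mem)
      then have "u n + (v + 1 *\<^sub>R (v - proj V (u n))) \<in> U + V"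
        using u(1) by (intro set_plus_intro)
      then show ?thesis by (simp add: d_def scaleR_2 algebra_simps)
    qed
    moreover have "(\<lambda>n. d n + 2 *\<^sub>R v) \<longlonglongrightarrow> d' + 2 *\<^sub>R v"
      by (intro tendsto_intros d')
    ultimately have "d' + 2 *\<^sub>R v \<in> U + V"
      using closed_sequentially[OF UV, of "\<lambda>n. d n + 2 *\<^sub>R v"] by simp
    then obtain u' q where uq: "u' \<in> U" "q \<in> V" "d' + 2 *\<^sub>R v = u' + q"
      by (auto elim: set_plus_elim)
    have "A d' + 2 *\<^sub>R b = A u' + b"
      using arg_cong[OF uq(3), of A] AV v uq(2) by (simp add: A.add A.scaleR)
    moreover have "A d' = y - b"
    proof (rule LIMSEQ_unique)
      show "(\<lambda>n. A (d n)) \<longlonglongrightarrow> A d'" by (intro A.tendsto d')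
      show "(\<lambda>n. A (d n)) \<longlonglongrightarrow> y - b" unfolding Ad by (intro tendsto_intros lim)
    qed
    ultimately have "y = A u'" by (simp add: scaleR_2 algebra_simps)
    then show ?thesis using uq(1) by blast
  qed
  then show ?thesis unfolding closed_sequential_limits by blast
qed

subsection \<open>Constrained least squares\<close>

lemma par_affine:
  assumes "affine U" "a \<in> U"
  shows "par U = (\<lambda>x. - a + x) ` U" and "subspace (par U)"
proof -
  have "u - v \<in> (\<lambda>x. - a + x) ` U" if "u \<in> U" "v \<in> U" for u v
    using affine_line_mem[OF assms that, of 1] by (intro image_eqI[of _ _ "a + (u - v)"]) auto
  moreover have "- a + u \<in> par U" if "u \<in> U" for u
    using that assms(2) unfolding par_def by force
  ultimately show *: "par U = (\<lambda>x. - a + x) ` U"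
    by (auto simp: par_def)
  show "subspace (par U)"
    unfolding * using assms by (rule affine_diffs_subspace)
qed

text \<open>Closedness passes by translation between the images of \<open>U\<close> and of its
  direction space.\<close>

lemma linear_image_par:
  assumes "linear A" "affine U" "a \<in> U"
  shows "A ` U = (+) (A a) ` (A ` par U)"
  unfolding par_affine(1)[OF assms(2,3)] image_image
  by (simp add: linear_add[OF assms(1), symmetric])

locale constrained_least_squares =
  fixes A :: "'x::{real_inner,complete_space} \<Rightarrow> 'y::{real_inner,complete_space}"
    and b :: 'y and U :: "'x set" and \<beta> :: real
  assumes A: "bounded_linear A"
    and U: "U \<noteq> {}" "closed U" "affine U"
    and \<beta>: "\<beta> = onorm (adjoint A \<circ> A)" "\<beta> > 0"
begin

interpretation A: bounded_linear A by (rule A)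

definition objective :: "'x \<Rightarrow> real" where
  "objective x = 1/2 * (norm (A x - b))\<^sup>2"

definition step :: "'x \<Rightarrow> 'x" where
  "step z = proj U (z - (1/\<beta>) *\<^sub>R adjoint A (A z - b))"

text \<open>Keeps the constraint outside a real-valued objective, so that extended reals enter only
  in the final translation.\<close>

definition solutions :: "'x set" where
  "solutions = {s \<in> U. \<forall>u\<in>U. objective s \<le> objective u}"

lemma affine_image: "affine (A ` U)"
  unfolding affine_def
proof (intro ballI allI impI)
  fix y z and c d :: real
  assume "y \<in> A ` U" "z \<in> A ` U" "c + d = 1"
  then obtain u v where uv: "u \<in> U" "v \<in> U" "y = A u" "z = A v" by blast
  then have "A (c *\<^sub>R u + d *\<^sub>R v) \<in> A ` U"
    using U(3) \<open>c + d = 1\<close> by (intro imageI mem_affine)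
  then show "c *\<^sub>R y + d *\<^sub>R z \<in> A ` U" by (simp add: uv A.add A.scaleR)
qed

text \<open>The exact second-order Taylor expansion at \<open>z\<close>; the middle term is the
  gradient paired with \<open>u - z\<close>.\<close>

lemma objective_expand:
  "objective u = objective z + (A z - b) \<bullet> A (u - z) + 1/2 * (norm (A (u - z)))\<^sup>2"
  by (simp add: objective_def power2_norm_eq_inner A.diff inner_commute algebra_simps)

lemma objective_convex:
  assumes "0 \<le> l" "l \<le> 1"
  shows "objective ((1 - l) *\<^sub>R x + l *\<^sub>R y) \<le> (1 - l) * objective x + l * objective y"
proof -
  have "(1 - l) * objective x + l * objective y - objective ((1 - l) *\<^sub>R x + l *\<^sub>R y)
      = l * (1 - l) * (1/2 * (norm (A (x - y)))\<^sup>2)"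
    by (simp add: objective_def power2_norm_eq_inner A.diff A.add A.scaleR inner_commute field_simps)
      (simp add: algebra_simps)
  also have "\<dots> \<ge> 0" using assms by simp
  finally show ?thesis by simp
qed

lemma step_mem: "step z \<in> U"
  unfolding step_def using U by (intro proj_closest) (auto intro: affine_imp_convex)

text \<open>Optimality of the projection, tested along a direction of \<open>U\<close>. For
  directions in the kernel of \<open>A\<close> the right side vanishes, which is the source of the
  orthogonality invariant.\<close>

lemma step_inner:
  assumes "u \<in> U" "v \<in> U"
  shows "\<beta> * ((step z - z) \<bullet> (u - v)) = - ((A z - b) \<bullet> A (u - v))"
proof -
  have "(z - (1/\<beta>) *\<^sub>R adjoint A (A z - b) - step z) \<bullet> (u - v) = 0"
    unfolding step_def using U assms by (intro proj_affine_orthogonal)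
  moreover have "adjoint A (A z - b) \<bullet> (u - v) = (A z - b) \<bullet> A (u - v)"
    by (metis adjoint_inner[OF A] inner_commute)
  ultimately have "(step z - z) \<bullet> (u - v) = - ((1/\<beta>) * ((A z - b) \<bullet> A (u - v)))"
    by (simp add: inner_diff_left)
  then show ?thesis using \<beta>(2) by simp
qed

text \<open>Combines the quadratic upper bound at \<open>z\<close>, the linear lower bound from
  convexity, and optimality of the projection. The point \<open>z\<close> is arbitrary because the
  iteration may start outside \<open>U\<close>.\<close>

lemma step_descent:
  assumes "u \<in> U"
  shows "objective (step z) + \<beta>/2 * (norm (u - step z))\<^sup>2 \<le> objective u + \<beta>/2 * (norm (u - z))\<^sup>2"
proof -
  have "objective (step z) \<le> objective z + (A z - b) \<bullet> A (step z - z) + \<beta>/2 * (norm (step z - z))\<^sup>2"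
    using norm_sq_le_onorm_adjoint[OF A, of "step z - z"]
    by (simp add: objective_expand[of "step z" z] \<beta>(1)[symmetric])
  moreover have "objective z + (A z - b) \<bullet> A (u - z) \<le> objective u"
    by (simp add: objective_expand[of u z])
  moreover have "(A z - b) \<bullet> A (u - z) - (A z - b) \<bullet> A (step z - z) = - (\<beta> * ((step z - z) \<bullet> (u - step z)))"
    using step_inner[OF assms step_mem, of z] by (simp add: A.diff inner_diff_right)
  \<comment> \<open>The three-point identity: the square expanded around
    \<open>step z\<close>.\<close>
  moreover have "\<beta>/2 * (norm (u - z))\<^sup>2 = \<beta>/2 * (norm (u - step z))\<^sup>2
      + \<beta> * ((step z - z) \<bullet> (u - step z)) + \<beta>/2 * (norm (step z - z))\<^sup>2"
    by (simp add: power2_norm_eq_inner inner_commute algebra_simps)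
  ultimately show ?thesis by linarith
qed

section \<open>Geometry of the solution set and the error bound\<close>

text \<open>A solution \<open>s\<close> makes \<open>A s\<close> a point closest to \<open>b\<close>
  in the affine image of \<open>U\<close>.\<close>

lemma solution_orthogonal:
  assumes "s \<in> solutions" "u \<in> U"
  shows "(A s - b) \<bullet> A (u - s) = 0"
proof -
  have "(b - A s) \<bullet> (A u - A s) = 0"
  proof (rule inner_minimal_affine_zero[of "A ` U"])
    show "affine (A ` U)" by (rule affine_image)
    show "norm (b - A s) \<le> norm (b - y)" if "y \<in> A ` U" for y
    proof -
      from that obtain v where "v \<in> U" "y = A v" by blast
      with assms(1) have "(norm (A s - b))\<^sup>2 \<le> (norm (A v - b))\<^sup>2"
        by (simp add: solutions_def objective_def)
      then show ?thesis
        using \<open>y = A v\<close> by (simp add: norm_minus_commute)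
    qed
  qed (use assms in \<open>auto simp: solutions_def\<close>)
  then show ?thesis by (simp add: A.diff inner_diff_left)
qed

text \<open>The first-order term vanishes by orthogonality, so the excess value controls the image
  distance exactly.\<close>

lemma objective_gap:
  assumes "s \<in> solutions" "u \<in> U"
  shows "objective u - objective s = 1/2 * (norm (A (u - s)))\<^sup>2"
  using objective_expand[of u s] solution_orthogonal[OF assms] by simp

lemma solutions_eq:
  assumes "s \<in> solutions"
  shows "solutions = {u \<in> U. A u = A s}"
proof (intro equalityI subsetI)
  fix u assume u: "u \<in> solutions"
  then have "u \<in> U" "objective u \<le> objective s"
    using assms by (auto simp: solutions_def)
  then have "(norm (A (u - s)))\<^sup>2 \<le> 0" using objective_gap[OF assms \<open>u \<in> U\<close>] by linarith
  then show "u \<in> {u \<in> U. A u = A s}" using \<open>u \<in> U\<close> by (simp add: A.diff)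
next
  fix u assume "u \<in> {u \<in> U. A u = A s}"
  then show "u \<in> solutions" using assms by (simp add: solutions_def objective_def)
qed

lemma solutions_closed_affine: "closed solutions" "affine solutions"
proof -
  consider "solutions = {}" | s where "s \<in> solutions" by blast
  then have "closed solutions \<and> affine solutions"
  proof cases
    case (2 s)
    have "solutions = U \<inter> A -` {A s}" using solutions_eq[OF 2] by auto
    moreover have "closed (A -` {A s})"
      by (intro closed_vimage A.continuous_on continuous_on_id closed_singleton)
    moreover have "affine (A -` {A s})"
      unfolding affine_def by (auto simp: A.add A.scaleR scaleR_add_left[symmetric])
    ultimately show ?thesis using U by (auto intro: affine_Int)
  qed simp
  then show "closed solutions" "affine solutions" by auto
qed

lemma solutions_nonempty:
  assumes "closed (A ` U)"
  shows "solutions \<noteq> {}"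
proof -
  note * = proj_closest[OF assms affine_imp_convex[OF affine_image], where x = b]
  have p: "proj (A ` U) b \<in> A ` U" using *(1) U(1) by blast
  obtain s where s: "s \<in> U" "proj (A ` U) b = A s" using p by blast
  have "objective s \<le> objective u" if "u \<in> U" for u
    using *(2)[of "A u"] U(1) that unfolding objective_def s(2)
    by (simp add: norm_minus_commute power_mono)
  then show ?thesis using s(1) by (auto simp: solutions_def)
qed

text \<open>The open mapping theorem supplies \<open>l\<close> in \<open>par U\<close> with the same
  image as \<open>u - p\<close> and controlled norm. The two differ by a kernel direction, to which
  \<open>u - p\<close> is orthogonal, so \<open>u - p\<close> is no longer than
  \<open>l\<close>.\<close>

lemma error_bound:
  assumes "closed (A ` U)"
  obtains C where "C \<ge> 0" and "\<And>u p. u \<in> U \<Longrightarrow> p \<in> U \<Longrightarrow>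
    (\<And>v w. v \<in> U \<Longrightarrow> w \<in> U \<Longrightarrow> A v = A w \<Longrightarrow> (u - p) \<bullet> (v - w) = 0) \<Longrightarrow>
    norm (u - p) \<le> C * norm (A (u - p))"
proof -
  obtain a where a: "a \<in> U" using U(1) by blast
  have "closed (par U)"
    unfolding par_affine(1)[OF U(3) a] using U(2) by (rule closed_translation)
  moreover have "A ` par U = (+) (- A a) ` (A ` U)"
    unfolding linear_image_par[OF A.linear_axioms U(3) a] by (simp add: image_image)
  then have "closed (A ` par U)"
    using closed_translation[OF assms, of "- A a"] by simp
  ultimately obtain C where C: "C \<ge> 0"
    "\<And>y. y \<in> A ` par U \<Longrightarrow> \<exists>x\<in>par U. A x = y \<and> norm x \<le> C * norm y"
    using bounded_linear_open_onto_image[OF A par_affine(2)[OF U(3) a]] by blast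
  have "norm (u - p) \<le> C * norm (A (u - p))"
    if up: "u \<in> U" "p \<in> U" and orth: "\<And>v w. v \<in> U \<Longrightarrow> w \<in> U \<Longrightarrow> A v = A w \<Longrightarrow> (u - p) \<bullet> (v - w) = 0"
    for u p
  proof -
    have "A (u - p) \<in> A ` par U" using up unfolding par_def by blast
    then obtain l where l: "l \<in> par U" "A l = A (u - p)" "norm l \<le> C * norm (A (u - p))"
      using C(2) by blast
    from l(1) obtain v w where vw: "v \<in> U" "w \<in> U" "l = v - w" by (auto simp: par_def)
    have "p + l \<in> U"
      using affine_line_mem[OF U(3) up(2) vw(1,2), of 1] vw(3) by simp
    then have "(u - p) \<bullet> (p + l - u) = 0"
      using up(1) l(2) by (intro orth) (auto simp: A.add A.diff)
    then have "(u - p) \<bullet> (u - p) = (u - p) \<bullet> l"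
      by (simp add: algebra_simps)
    then have "norm (u - p) * norm (u - p) \<le> norm (u - p) * norm l"
      by (metis norm_cauchy_schwarz power2_eq_square power2_norm_eq_inner)
    then have "norm (u - p) \<le> norm l"
      by (cases "u = p") auto
    then show ?thesis using l(3) by simp
  qed
  with C(1) show ?thesis by (rule that)
qed

section \<open>Convergence of momentum iterations\<close>

text \<open>The statement carries \<open>r k\<close> along because the step starts at
  \<open>x k + r k\<close>. The coefficients only rescale increments, so any real sequence is
  allowed.\<close>

lemma momentum_orthogonal:
  assumes x: "\<And>k. x (Suc k) = step (x k + r k)"
    and r: "r 0 = 0" "\<And>k. r (Suc k) = \<alpha> k *\<^sub>R (x (Suc k) - x k)"
    and vw: "v \<in> U" "w \<in> U" "A v = A w"
  shows "(x k - x 0) \<bullet> (v - w) = 0 \<and> r k \<bullet> (v - w) = 0"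
proof (induction k)
  case 0
  show ?case by (simp add: r)
next
  case (Suc k)
  have "\<beta> * ((x (Suc k) - (x k + r k)) \<bullet> (v - w)) = 0"
    unfolding x step_inner[OF vw(1,2)] using vw(3) by (simp add: A.diff)
  then have *: "(x (Suc k) - x k) \<bullet> (v - w) = 0"
    using \<beta>(2) Suc by (simp add: inner_diff_left inner_add_left)
  then show ?case using Suc by (simp add: r inner_diff_left)
qed

text \<open>All iterates share the projection \<open>p\<close> of \<open>x 0\<close> onto the
  solutions, so the error bound applies to each \<open>x (Suc k) - p\<close>. The index is shifted
  because \<open>x 0\<close> may lie outside \<open>U\<close>.\<close>

lemma momentum_converges:
  assumes cl: "closed (A ` U)"
    and x: "\<And>k. x (Suc k) = step (x k + r k)"
    and r: "r 0 = 0" "\<And>k. r (Suc k) = \<alpha> k *\<^sub>R (x (Suc k) - x k)"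
    and s: "s \<in> solutions" and lim: "(\<lambda>k. objective (x (Suc k)) - objective s) \<longlonglongrightarrow> 0"
  shows "x \<longlonglongrightarrow> proj solutions (x 0)"
proof -
  define p where "p = proj solutions (x 0)"
  have p: "p \<in> solutions"
    unfolding p_def using solutions_closed_affine s
    by (intro proj_closest) (auto intro: affine_imp_convex)
  then have pU: "p \<in> U" by (simp add: solutions_def)
  have xU: "x (Suc k) \<in> U" for k unfolding x by (rule step_mem)
  \<comment> \<open>Moving \<open>p\<close> along a kernel direction of \<open>U\<close> gives
    another solution, so projecting \<open>x 0\<close> yields this orthogonality.\<close>
  have orth0: "(x 0 - p) \<bullet> (v - w) = 0" if vw: "v \<in> U" "w \<in> U" "A v = A w" for v w
  proof -
    have "p + 1 *\<^sub>R (v - w) \<in> U" using U(3) pU vw by (intro affine_line_mem)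
    then have "p + (v - w) \<in> solutions"
      unfolding solutions_eq[OF p] using vw(3) by (simp add: A.add A.diff)
    then have "(x 0 - p) \<bullet> (p + (v - w) - p) = 0"
      unfolding p_def using solutions_closed_affine p[unfolded p_def] by (intro proj_affine_orthogonal) auto
    then show ?thesis by simp
  qed
  obtain C where C: "C \<ge> 0" "\<And>u p. u \<in> U \<Longrightarrow> p \<in> U \<Longrightarrow>
    (\<And>v w. v \<in> U \<Longrightarrow> w \<in> U \<Longrightarrow> A v = A w \<Longrightarrow> (u - p) \<bullet> (v - w) = 0) \<Longrightarrow>
    norm (u - p) \<le> C * norm (A (u - p))"
    using error_bound[OF cl] by metis
  have "norm (x (Suc k) - p) \<le> C * sqrt (2 * (objective (x (Suc k)) - objective s))" for k
  proof -
    have "norm (x (Suc k) - p) \<le> C * norm (A (x (Suc k) - p))"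
    proof (rule C(2)[of "x (Suc k)" p, OF xU pU])
      fix v w assume vw: "v \<in> U" "w \<in> U" "A v = A w"
      have "(x (Suc k) - x 0) \<bullet> (v - w) = 0"
        using momentum_orthogonal[OF x r vw, of "Suc k"] by blast
      then show "(x (Suc k) - p) \<bullet> (v - w) = 0"
        using orth0[OF vw] by (simp add: inner_diff_left)
    qed
    moreover have "objective p = objective s"
      using p s by (auto simp: solutions_def intro: antisym)
    then have "norm (A (x (Suc k) - p)) = sqrt (2 * (objective (x (Suc k)) - objective s))"
      using objective_gap[OF p xU[of k]] by (intro real_sqrt_unique[symmetric]) auto
    ultimately show ?thesis by simp
  qed
  then have bound: "\<forall>\<^sub>F k in sequentially.
      norm (x (Suc k) - p) \<le> C * sqrt (2 * (objective (x (Suc k)) - objective s))"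
    by (intro always_eventually allI)
  have "(\<lambda>k. C * sqrt (2 * (objective (x (Suc k)) - objective s))) \<longlonglongrightarrow> C * sqrt (2 * 0)"
    by (intro tendsto_intros lim)
  then have "(\<lambda>k. C * sqrt (2 * (objective (x (Suc k)) - objective s))) \<longlonglongrightarrow> 0" by simp
  with bound have "(\<lambda>k. x (Suc k) - p) \<longlonglongrightarrow> 0"
    by (rule Lim_null_comparison)
  then have "(\<lambda>k. x (Suc k)) \<longlonglongrightarrow> p" by (simp add: LIM_zero_iff)
  then show ?thesis unfolding p_def by (rule LIMSEQ_imp_Suc)
qed

text \<open>
  The Lyapunov function of Beck and Teboulle; its induction step is the descent inequality
  tested at \<open>(1 - 1 / t (Suc k)) *\<^sub>R x (Suc k) + (1 / t (Suc k)) *\<^sub>R s\<close>.  The start \<open>x 0\<close> may lie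
  outside \<open>U\<close>: on the left it enters only with the factor \<open>t 0 - 1 = 0\<close>.
\<close>
lemma fista_energy:
  assumes t: "\<And>k. t k \<ge> 1" "t 0 = 1" "\<And>k. (t k)\<^sup>2 \<ge> (t (Suc k))\<^sup>2 - t (Suc k)"
    and x: "\<And>k. x (Suc k) = step (y k)" "y 0 = x 0"
    and y: "\<And>k. y (Suc k) = x (Suc k) + ((t k - 1) / t (Suc k)) *\<^sub>R (x (Suc k) - x k)"
    and s: "s \<in> solutions"
  shows "(t k)\<^sup>2 * (objective (x (Suc k)) - objective s)
      + \<beta>/2 * (norm (t k *\<^sub>R x (Suc k) - (t k - 1) *\<^sub>R x k - s))\<^sup>2 \<le> \<beta>/2 * (norm (x 0 - s))\<^sup>2"
proof (induction k)
  case 0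
  have "s \<in> U" using s by (simp add: solutions_def)
  from step_descent[OF this, of "y 0"] show ?case
    by (simp add: t(2) x norm_minus_commute)
next
  case (Suc k)
  define \<tau> where "\<tau> = t (Suc k)"
  define X where "X = x (Suc k)"
  define Z where "Z = x (Suc (Suc k))"
  define u where "u = (1 - 1/\<tau>) *\<^sub>R X + (1/\<tau>) *\<^sub>R s"
  have \<tau>: "\<tau> \<ge> 1" by (simp add: \<tau>_def t)
  have sU: "s \<in> U" using s by (simp add: solutions_def)
  have XU: "X \<in> U" unfolding X_def x by (rule step_mem)
  have "u \<in> U" unfolding u_def using U(3) XU sU by (intro mem_affine) auto
  from step_descent[OF this, of "y (Suc k)"]
  have "objective Z + \<beta>/2 * (norm (u - Z))\<^sup>2 \<le> objective u + \<beta>/2 * (norm (u - y (Suc k)))\<^sup>2"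
    by (simp add: Z_def x)
  moreover have "objective u \<le> (1 - 1/\<tau>) * objective X + (1/\<tau>) * objective s"
    unfolding u_def using \<tau> by (intro objective_convex) auto
  ultimately have "\<tau>\<^sup>2 * (objective Z + \<beta>/2 * (norm (u - Z))\<^sup>2)
      \<le> \<tau>\<^sup>2 * ((1 - 1/\<tau>) * objective X + (1/\<tau>) * objective s + \<beta>/2 * (norm (u - y (Suc k)))\<^sup>2)"
    by (intro mult_left_mono) auto
  also have "\<dots> = (\<tau>\<^sup>2 - \<tau>) * objective X + \<tau> * objective s + \<beta>/2 * (norm (\<tau> *\<^sub>R (u - y (Suc k))))\<^sup>2"
    using \<tau> by (simp add: power_mult_distrib del: scaleR_diff_right) (simp add: field_simps power2_eq_square)
  \<comment> \<open>The extrapolation coefficient is chosen so that this vector is, up to sign, the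
    one in the energy at \<open>k\<close>.\<close>
  also have "\<tau> *\<^sub>R (u - y (Suc k)) = - (t k *\<^sub>R X - (t k - 1) *\<^sub>R x k - s)"
  proof -
    have "\<tau> *\<^sub>R u = (\<tau> - 1) *\<^sub>R X + s"
      using \<tau> by (simp add: u_def scaleR_add_right right_diff_distrib)
    moreover have "\<tau> *\<^sub>R y (Suc k) = \<tau> *\<^sub>R X + (t k - 1) *\<^sub>R (X - x k)"
      using \<tau> by (simp add: y \<tau>_def[symmetric] X_def[symmetric] scaleR_add_right)
    ultimately show ?thesis by (simp add: scaleR_diff_right scaleR_diff_left)
  qed
  also have "\<tau>\<^sup>2 * (objective Z + \<beta>/2 * (norm (u - Z))\<^sup>2)
      = \<tau>\<^sup>2 * objective Z + \<beta>/2 * (norm (\<tau> *\<^sub>R (u - Z)))\<^sup>2"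
    by (simp add: power_mult_distrib distrib_left)
  also have "\<tau> *\<^sub>R (u - Z) = - (\<tau> *\<^sub>R Z - (\<tau> - 1) *\<^sub>R X - s)"
    using \<tau> by (simp add: u_def scaleR_diff_right scaleR_add_right scaleR_diff_left right_diff_distrib)
  finally have "\<tau>\<^sup>2 * objective Z + \<beta>/2 * (norm (\<tau> *\<^sub>R Z - (\<tau> - 1) *\<^sub>R X - s))\<^sup>2
      \<le> (\<tau>\<^sup>2 - \<tau>) * objective X + \<tau> * objective s + \<beta>/2 * (norm (t k *\<^sub>R X - (t k - 1) *\<^sub>R x k - s))\<^sup>2"
    unfolding norm_minus_cancel .
  \<comment> \<open>Here the growth condition on \<open>t\<close> enters; it is multiplied by a
    nonnegative gap, as \<open>X\<close> lies in \<open>U\<close>.\<close>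
  moreover have "(\<tau>\<^sup>2 - \<tau>) * (objective X - objective s) \<le> (t k)\<^sup>2 * (objective X - objective s)"
    using t(3)[of k] s XU by (intro mult_right_mono) (auto simp: \<tau>_def solutions_def)
  ultimately have "\<tau>\<^sup>2 * (objective Z - objective s) + \<beta>/2 * (norm (\<tau> *\<^sub>R Z - (\<tau> - 1) *\<^sub>R X - s))\<^sup>2
      \<le> (t k)\<^sup>2 * (objective X - objective s) + \<beta>/2 * (norm (t k *\<^sub>R X - (t k - 1) *\<^sub>R x k - s))\<^sup>2"
    unfolding left_diff_distrib right_diff_distrib by linarith
  also have "\<dots> \<le> \<beta>/2 * (norm (x 0 - s))\<^sup>2"
    using Suc by (simp add: X_def)
  finally show ?case by (simp add: \<tau>_def X_def Z_def)
qed

lemma fista_objective_tendsto: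
  assumes t: "\<And>k. t k \<ge> (real k + 2) / 2" "t 0 = 1" "\<And>k. (t k)\<^sup>2 \<ge> (t (Suc k))\<^sup>2 - t (Suc k)"
    and x: "\<And>k. x (Suc k) = step (y k)" "y 0 = x 0"
    and y: "\<And>k. y (Suc k) = x (Suc k) + ((t k - 1) / t (Suc k)) *\<^sub>R (x (Suc k) - x k)"
    and s: "s \<in> solutions"
  shows "(\<lambda>k. objective (x (Suc k)) - objective s) \<longlonglongrightarrow> 0"
proof -
  define c where "c = \<beta>/2 * (norm (x 0 - s))\<^sup>2"
  have c: "c \<ge> 0" using \<beta>(2) by (simp add: c_def)
  have t1: "t k \<ge> 1" for k using t(1)[of k] by simp
  have nonneg: "objective (x (Suc k)) - objective s \<ge> 0" for k
    using s step_mem by (auto simp: x(1) solutions_def)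
  have "norm (objective (x (Suc k)) - objective s) \<le> c * 4 * (1 / real (Suc k))" for k
  proof -
    have "(t k)\<^sup>2 * (objective (x (Suc k)) - objective s) \<le> c"
      using fista_energy[OF t1 t(2,3) x y s, of k] \<beta>(2)
      by (smt (verit) c_def mult_nonneg_nonneg zero_le_power2 divide_nonneg_nonneg)
    \<comment> \<open>A linear lower bound suffices, since only convergence of the values is wanted
      and not the full quadratic rate.\<close>
    moreover have "real (Suc k) / 4 \<le> (t k)\<^sup>2"
    proof -
      have "real (Suc k) / 4 \<le> t k * 1" using t(1)[of k] by simp
      also have "\<dots> \<le> t k * t k" using t1[of k] by (intro mult_left_mono) auto
      finally show ?thesis by (simp add: power2_eq_square)
    qed
    ultimately have "real (Suc k) / 4 * (objective (x (Suc k)) - objective s) \<le> c"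
      using mult_right_mono[OF _ nonneg[of k]] order_trans by blast
    then show ?thesis using nonneg[of k] by (simp add: field_simps)
  qed
  then have "\<forall>\<^sub>F k in sequentially.
      norm (objective (x (Suc k)) - objective s) \<le> c * 4 * (1 / real (Suc k))"
    by (intro always_eventually allI)
  moreover have "(\<lambda>k. c * 4 * (1 / real (Suc k))) \<longlonglongrightarrow> 0"
    using tendsto_mult_right_zero[OF LIMSEQ_inverse_real_of_nat, of "c * 4"] by (simp add: inverse_eq_divide)
  ultimately show ?thesis
    by (rule Lim_null_comparison)
qed

section \<open>Translation from the extended-real problem\<close>

lemma minimizers_eq_solutions:
  "minimizers (\<lambda>x. ereal (objective x) + iota U x) = solutions"
proof (intro equalityI subsetI)
  fix s assume "s \<in> minimizers (\<lambda>x. ereal (objective x) + iota U x)"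
  then have min: "ereal (objective s) + iota U s \<le> ereal (objective x) + iota U x" for x
    by (auto simp: minimizers_def is_arg_min_def not_less)
  obtain a where "a \<in> U" using U(1) by blast
  then have "s \<in> U" using min[of a] by (auto simp: iota_def split: if_splits)
  moreover have "objective s \<le> objective u" if "u \<in> U" for u
    using min[of u] that \<open>s \<in> U\<close> by (simp add: iota_def)
  ultimately show "s \<in> solutions" by (simp add: solutions_def)
next
  fix s assume "s \<in> solutions"
  then show "s \<in> minimizers (\<lambda>x. ereal (objective x) + iota U x)"
    by (auto simp: minimizers_def is_arg_min_def not_less solutions_def iota_def)
qed

text \<open>The infimum is attained and finite, so subtracting it is ordinary real subtraction at
  points of \<open>U\<close>.\<close>

lemma Inf_range_objective:
  assumes "s \<in> solutions"
  shows "Inf (range (\<lambda>x. ereal (objective x) + iota U x)) = ereal (objective s)"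
proof (rule Inf_eqI)
  show "ereal (objective s) \<le> z" if "z \<in> range (\<lambda>x. ereal (objective x) + iota U x)" for z
    using that assms by (auto simp: solutions_def iota_def)
  show "z \<le> ereal (objective s)"
    if "\<And>w. w \<in> range (\<lambda>x. ereal (objective x) + iota U x) \<Longrightarrow> z \<le> w" for z
    using that[of "ereal (objective s) + iota U s"] assms by (simp add: solutions_def iota_def)
qed

text \<open>The three alternatives meet here: the first and the third go through the direction space
  \<open>par U\<close>, the second acts on \<open>U\<close> directly.\<close>

lemma closed_image_cases:
  assumes "(closed (range A) \<and> closed (par U + {x. A x = 0}))
      \<or> (\<exists>V. V \<noteq> {} \<and> closed V \<and> affine V \<and> (\<forall>x. objective x = 1/2 * (dist_set x V)\<^sup>2) \<and> closed (U + V))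
      \<or> finite_dim TYPE('x)"
  shows "closed (A ` U)"
proof -
  have lin: "linear A" using A by (rule bounded_linear.linear)
  obtain a where a: "a \<in> U" using U(1) by blast
  have shift: "closed (A ` U)" if "closed (A ` par U)"
    unfolding linear_image_par[OF lin U(3) a] using that by (rule closed_translation)
  from assms show ?thesis
  proof (elim disjE exE conjE)
    assume "closed (range A)" "closed (par U + {x. A x = 0})"
    then show ?thesis by (rule shift[OF closed_image_of_closed_sum_kernel[OF A]])
  next
    fix V assume V: "V \<noteq> {}" "closed V" "affine V" "closed (U + V)"
      "\<forall>x. objective x = 1/2 * (dist_set x V)\<^sup>2"
    have "norm (A x - b) = dist_set x V" for x
    proof (rule power2_eq_imp_eq)
      show "(norm (A x - b))\<^sup>2 = (dist_set x V)\<^sup>2"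
        using V(5)[rule_format, of x] by (simp add: objective_def)
    qed (simp_all add: dist_set_def)
    then show ?thesis using closed_image_of_distance_residual[OF A V(1-3) _ V(4)] by blast
  next
    assume "finite_dim TYPE('x)"
    then show ?thesis by (rule shift[OF finite_dim_image_closed[OF _ lin par_affine(2)[OF U(3) a]]])
  qed
qed

end

theorem theorem5p4:
  fixes A :: "'x::{real_inner,complete_space} \<Rightarrow> 'y::{real_inner,complete_space}"
    and b :: 'y
    and U S :: "'x set"
    and f :: "'x \<Rightarrow> real"
    and g F :: "'x \<Rightarrow> ereal"
    and \<mu> :: ereal
    and \<beta> :: real
    and T :: "'x \<Rightarrow> 'x"
  assumes A: "bounded_linear A"
    and U: "U \<noteq> {}" "closed U" "affine U"
    and f: "f = (\<lambda>x. 1/2 * (norm (A x - b))\<^sup>2)"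
    and g: "g = iota U"
    and F: "F = (\<lambda>x. ereal (f x) + g x)"
    and S: "S = minimizers F"
    and \<mu>: "\<mu> = Inf (range F)"
    and \<beta>: "\<beta> = onorm (adjoint A \<circ> A)" "\<beta> > 0"
    and T: "T = (\<lambda>x. proj U (x - (1/\<beta>) *\<^sub>R adjoint A (A x - b)))"
    and cases: "(S \<noteq> {} \<and> closed (range A) \<and> closed (par U + {x. A x = 0}))
      \<or> (\<exists>V. V \<noteq> {} \<and> closed V \<and> affine V \<and> (\<forall>x. f x = 1/2 * (dist_set x V)\<^sup>2) \<and> closed (U + V))
      \<or> finite_dim TYPE('x)"
  shows "(\<forall>(\<alpha>::nat \<Rightarrow> real) x0 (x::nat \<Rightarrow> 'x) r.
            x 0 = x0 \<longrightarrow> r 0 = 0 \<longrightarrow>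
            (\<forall>k. x (Suc k) = T (x k + r k)) \<longrightarrow>
            (\<forall>k. r (Suc k) = \<alpha> k *\<^sub>R (x (Suc k) - x k)) \<longrightarrow>
            (\<lambda>k. F (x k) - \<mu>) \<longlonglongrightarrow> 0 \<longrightarrow>
            x \<longlonglongrightarrow> proj S x0)
       \<and> (\<forall>(t::nat \<Rightarrow> real) \<alpha> x0 (x::nat \<Rightarrow> 'x) y.
            (\<forall>k. t k > 0) \<longrightarrow>
            (\<forall>k. t k \<ge> (real k + 2) / 2) \<longrightarrow> t 0 = 1 \<longrightarrow>
            (\<forall>k. (t k)\<^sup>2 \<ge> (t (Suc k))\<^sup>2 - t (Suc k)) \<longrightarrow>
            (\<forall>k. \<alpha> k = (t k - 1) / t (Suc k)) \<longrightarrow>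
            x 0 = x0 \<longrightarrow> y 0 = x0 \<longrightarrow>
            (\<forall>k. x (Suc k) = T (y k)) \<longrightarrow>
            (\<forall>k. y (Suc k) = x (Suc k) + \<alpha> k *\<^sub>R (x (Suc k) - x k)) \<longrightarrow>
            x \<longlonglongrightarrow> proj S x0)"
proof -
  interpret constrained_least_squares A b U \<beta>
    by (intro constrained_least_squares.intro A U \<beta>)
  have f_eq: "f = objective" unfolding f by (rule ext) (simp add: objective_def)
  have T_eq: "T = step" unfolding T by (rule ext) (simp add: step_def)
  have F_eq: "F = (\<lambda>x. ereal (objective x) + iota U x)" by (simp add: F f_eq g)
  have S_eq: "S = solutions" unfolding S F_eq by (rule minimizers_eq_solutions)
  have cl: "closed (A ` U)"
    by (rule closed_image_cases) (use cases in \<open>auto simp: f_eq\<close>)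
  obtain s where s: "s \<in> solutions" using solutions_nonempty[OF cl] by blast
  have \<mu>_eq: "\<mu> = ereal (objective s)"
    unfolding \<mu> F_eq by (rule Inf_range_objective[OF s])
  have main: "x \<longlonglongrightarrow> proj S (x 0)"
    if x: "\<And>k. x (Suc k) = T (x k + r k)"
      and r: "r 0 = 0" "\<And>k. r (Suc k) = \<alpha> k *\<^sub>R (x (Suc k) - x k)"
      and lim: "(\<lambda>k. F (x k) - \<mu>) \<longlonglongrightarrow> 0" for \<alpha> :: "nat \<Rightarrow> real" and x r
  proof -
    \<comment> \<open>From index 1 on the iterates are feasible and the values real;
      \<open>F (x 0)\<close> may be infinite.\<close>
    have "x (Suc k) \<in> U" for k unfolding x T_eq by (rule step_mem)
    then have "F (x (Suc k)) - \<mu> = ereal (objective (x (Suc k)) - objective s)" for k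
      by (simp add: F_eq \<mu>_eq iota_def)
    with LIMSEQ_Suc[OF lim] have "(\<lambda>k. objective (x (Suc k)) - objective s) \<longlonglongrightarrow> 0"
      by (simp add: zero_ereal_def)
    then show ?thesis
      unfolding S_eq using momentum_converges[OF cl, of x r \<alpha> s] x r s by (simp add: T_eq)
  qed
  have fista: "x \<longlonglongrightarrow> proj S (x 0)"
    if t: "\<And>k. t k \<ge> (real k + 2) / 2" "t 0 = 1" "\<And>k. (t k)\<^sup>2 \<ge> (t (Suc k))\<^sup>2 - t (Suc k)"
      and y0: "y 0 = x 0" and x: "\<And>k. x (Suc k) = T (y k)"
      and y: "\<And>k. y (Suc k) = x (Suc k) + ((t k - 1) / t (Suc k)) *\<^sub>R (x (Suc k) - x k)"
    for t :: "nat \<Rightarrow> real" and x y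
  proof -
    have "(\<lambda>k. objective (x (Suc k)) - objective s) \<longlonglongrightarrow> 0"
      using t x[unfolded T_eq] y0 y s by (rule fista_objective_tendsto)
    then show ?thesis
      unfolding S_eq
      \<comment> \<open>The accelerated scheme is the momentum iteration with
        \<open>r k = y k - x k\<close>; it starts at zero because \<open>y 0 = x 0\<close>.\<close>
      using momentum_converges[OF cl, of x "\<lambda>k. y k - x k" "\<lambda>k. (t k - 1) / t (Suc k)" s] s y0 y
      by (simp add: x T_eq)
  qed
  show ?thesis
  proof (intro conjI allI impI, goal_cases)
    case (1 \<alpha> x0 x r)
    show ?case unfolding \<open>x 0 = x0\<close>[symmetric]
      by (rule main[of x r \<alpha>]; use 1 in blast)
  next
    case (2 t \<alpha> x0 x y)
    show ?case unfolding \<open>x 0 = x0\<close>[symmetric]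
      by (rule fista[of t y x]; use 2 in simp)
  qed
qed

end
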